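(* Let $a\ge 1$ be an integer, let $k=2a$, and let $G=(\mathbb{Z}_{k^2+1},+)$. (i) Let $B_1=\{0,1,\ldots,a-1\}\cup\{2a,2a+1,\ldots,3a-1\}$ and $B_2=\bigcup_{i=1}^{a}\{(4i-1)a,\,4ia\}$. Then $\{B_1,B_2\}$ is a $(k^2+1,2,k,1)$-SEDF in $G$. (ii) For $k>2$, the SEDF $\{B_1,B_2\}$ is not equivalent to the $(k^2+1,2,k,1)$-SEDF $\{A_1,A_2\}$ in $\mathbb{Z}_{k^2+1}$ with $A_1=\{0,1,\ldots,k-1\}$ and $A_2=\{k,2k,\ldots,k^2\}$.
   Context: For an additive group $G$ of order $n$, an $(n,m,k,\lambda)$-SEDF is a set of $m\ge2$ pairwise disjoint $k$-subsets $A_1,\ldots,A_m$ of $G$ such that for every $i$ the multiset $\{x-y: x\in A_i, y\in \bigcup_{j\neq i}A_j\}$ contains every non-zero element of $G$ exactly $\lambda$ times. Two $(n,m,k,\lambda)$-SEDFs $\{A_1,\ldots,A_m\}$ and $\{A'_1,\ldots,A'_m\}$ over the same group $G$ are equivalent if there exist an automorphism $\alpha$ of $G$ and elements $g,h\in G$ such that (after suitable ordering of the sets) $A'_i=h\,\alpha(A_i)\,g$ for all $i$; for $G=\mathbb{Z}_n$ this means there are a unit $u$ of $\mathbb{Z}_n$ and $c\in\mathbb{Z}_n$ with $\{A'_1,\ldots,A'_m\}=\{uA_1+c,\ldots,uA_m+c\}$. Elements of $\mathbb{Z}_n$ are $\{0,1,\ldots,n-1\}$. *)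

theory Defs
  imports "HOL-Algebra.Elementary_Groups" "HOL-Library.Disjoint_Sets" "HOL-Library.Multiset"
begin

text \<open>
  HOL-Algebra groups are written multiplicatively, so the difference \<open>x - y\<close> of an additively
  written group is \<open>x \<otimes> inv y\<close>.
\<close>

definition diff_mset :: "('a, 'b) monoid_scheme \<Rightarrow> 'a set \<Rightarrow> 'a set \<Rightarrow> 'a multiset" where
  "diff_mset G X Y = image_mset (\<lambda>(x, y). x \<otimes>\<^bsub>G\<^esub> inv\<^bsub>G\<^esub> y) (mset_set (X \<times> Y))"

text \<open>
  Finiteness of the carrier is stated explicitly because \<^const>\<open>order\<close> is \<open>0\<close> on infinite groups.
\<close>

definition is_SEDF ::
  "('a, 'b) monoid_scheme \<Rightarrow> nat \<Rightarrow> nat \<Rightarrow> nat \<Rightarrow> nat \<Rightarrow> 'a set set \<Rightarrow> bool" where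
  "is_SEDF G n m k l \<A> \<longleftrightarrow>
     group G \<and> finite (carrier G) \<and> order G = n \<and>
     m \<ge> 2 \<and> finite \<A> \<and> card \<A> = m \<and> disjoint \<A> \<and>
     (\<forall>A\<in>\<A>. A \<subseteq> carrier G \<and> card A = k) \<and>
     (\<forall>A\<in>\<A>. \<forall>g\<in>carrier G - {\<one>\<^bsub>G\<^esub>}. count (diff_mset G A (\<Union>(\<A> - {A}))) g = l)"

text \<open>
  Equality of the two unordered families expresses that the sets agree after a suitable ordering.
\<close>

definition SEDF_equivalent ::
  "('a, 'b) monoid_scheme \<Rightarrow> 'a set set \<Rightarrow> 'a set set \<Rightarrow> bool" where
  "SEDF_equivalent G \<A> \<A>' \<longleftrightarrow>
     (\<exists>\<alpha>\<in>iso G G. \<exists>g\<in>carrier G. \<exists>h\<in>carrier G.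
        \<A>' = (\<lambda>A. (\<lambda>x. h \<otimes>\<^bsub>G\<^esub> \<alpha> x \<otimes>\<^bsub>G\<^esub> g) ` A) ` \<A>)"

end

theory Submission
  imports Defs
begin

text \<open>
  Every \<open>d \<in> {1..k\<^sup>2}\<close> is uniquely \<open>c * s - r\<close> with \<open>r \<in> {0..s - 1}\<close>; taking \<open>s = k\<close> resp. \<open>s = a\<close>
  exhibits each such \<open>d\<close> as an integer difference from \<open>A2 - A1\<close> resp. \<open>B2 - B1\<close>. As there are only
  \<open>k\<^sup>2\<close> pairs, each non-zero difference occurs exactly once, and the two sets are disjoint.

  For non-equivalence, \<open>A1\<close> and \<open>A2\<close> are arithmetic progressions, so translation by a suitable
  non-zero element moves at most one of their points outside the set. This property survives
  equivalence, but every non-zero translation moves at least two points of \<open>B1\<close> outside \<open>B1\<close>.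
\<close>

text \<open>Pigeonhole: \<open>card X * card Y\<close> pairs cover at least that many values, so the
  difference map is injective on \<open>X \<times> Y\<close> and no value is hit twice.\<close>

lemma count_diff_mset_eq_1:
  fixes G (structure)
  assumes "finite X" "finite Y"
    and sub: "D \<subseteq> (\<lambda>(x, y). x \<otimes> inv y) ` (X \<times> Y)"
    and le: "card X * card Y \<le> card D" and "g \<in> D"
  shows "count (diff_mset G X Y) g = 1"
proof -
  let ?f = "\<lambda>(x, y). x \<otimes> inv y"
  have fin: "finite (X \<times> Y)" using assms by simp
  have "card D \<le> card (?f ` (X \<times> Y))" using sub fin by (intro card_mono) auto
  moreover have "card (?f ` (X \<times> Y)) \<le> card (X \<times> Y)" by (rule card_image_le[OF fin])
  ultimately have "card (?f ` (X \<times> Y)) = card (X \<times> Y)" using le by (simp add: card_cartesian_product)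
  then have "inj_on ?f (X \<times> Y)" by (rule eq_card_imp_inj_on[OF fin])
  then have "diff_mset G X Y = mset_set (?f ` (X \<times> Y))"
    unfolding diff_mset_def by (rule image_mset_mset_set)
  then show ?thesis
    using subsetD[OF sub \<open>g \<in> D\<close>] count_mset_set(1)[OF finite_imageI[OF fin]] by metis
qed

text \<open>Reduces the SEDF property to one covering statement about integer differences, before
  any reduction modulo \<open>k\<^sup>2 + 1\<close>. Upper bounds on the cardinalities suffice:
  covering \<open>k\<^sup>2\<close> values takes \<open>k\<^sup>2\<close> pairs, which forces both
  sets to have exactly \<open>k\<close> elements.\<close>

lemma is_SEDF_integer_mod_group:
  fixes k :: nat and X Y :: "int set"
  assumes "k \<ge> 1" and X: "X \<subseteq> {0..int (k\<^sup>2)}" and Y: "Y \<subseteq> {0..int (k\<^sup>2)}"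
    and cX: "card X \<le> k" and cY: "card Y \<le> k"
    and diffs: "\<And>d. d \<in> {1..int (k\<^sup>2)} \<Longrightarrow> \<exists>x\<in>X. \<exists>y\<in>Y. y - x = d"
  shows "is_SEDF (integer_mod_group (k\<^sup>2 + 1)) (k\<^sup>2 + 1) 2 k 1 {X, Y}"
proof -
  define G where "G = integer_mod_group (k\<^sup>2 + 1)"
  define n where "n = int (k\<^sup>2) + 1"
  have carr: "carrier G = {0..int (k\<^sup>2)}"
    by (auto simp: G_def carrier_integer_mod_group)
  have finX: "finite X" and finY: "finite Y" using X Y finite_subset by blast+
  have diff: "x \<otimes>\<^bsub>G\<^esub> inv\<^bsub>G\<^esub> y = (x - y) mod n" if "y \<in> carrier G" for x y
    using that by (simp add: G_def n_def mod_add_right_eq add.commute)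
  have sub: "{1..int (k\<^sup>2)} \<subseteq> (\<lambda>(x, y). y - x) ` (X \<times> Y)"
    using diffs by force
  have card_le: "card ((\<lambda>(x, y). y - x) ` (X \<times> Y)) \<le> card X * card Y"
    using card_image_le[of "X \<times> Y" "\<lambda>(x, y). y - x"] finX finY
    by (simp add: card_cartesian_product)
  have "k * k \<le> card X * card Y"
    using card_mono[OF _ sub] card_le finX finY
    by (simp add: power2_eq_square flip: of_nat_mult)
  then have kX: "card X = k" and kY: "card Y = k"
    using cX cY \<open>k \<ge> 1\<close> mult_le_mono[OF cX order_refl[of k]] mult_le_mono
    by (metis le_antisym mult.commute mult_le_cancel2 order.trans le_refl not_one_le_zero gr0I)+
  have disj: "X \<inter> Y = {}"
  \<comment> \<open>A common point would add the difference 0, giving \<open>k\<^sup>2 + 1\<close>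
    values from only \<open>k\<^sup>2\<close> pairs.\<close>
  proof (rule ccontr)
    assume "X \<inter> Y \<noteq> {}"
    then have "0 \<in> (\<lambda>(x, y). y - x) ` (X \<times> Y)" by force
    with sub have "insert 0 {1..int (k\<^sup>2)} \<subseteq> (\<lambda>(x, y). y - x) ` (X \<times> Y)" by blast
    from card_mono[OF _ this] show False
      using card_le finX finY kX kY by (simp add: power2_eq_square flip: of_nat_mult)
  qed
  moreover have "X \<noteq> {}" using kX \<open>k \<ge> 1\<close> by auto
  ultimately have ne: "X \<noteq> Y" by auto
  have inY: "y \<in> carrier G" if "y \<in> Y" for y using that Y carr by auto
  have inX: "x \<in> carrier G" if "x \<in> X" for x using that X carr by auto
  have YX: "count (diff_mset G Y X) g = 1" if "g \<in> {1..int (k\<^sup>2)}" for g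
  proof (rule count_diff_mset_eq_1[OF finY finX _ _ that])
    show "{1..int (k\<^sup>2)} \<subseteq> (\<lambda>(x, y). x \<otimes>\<^bsub>G\<^esub> inv\<^bsub>G\<^esub> y) ` (Y \<times> X)"
    proof
      fix d assume d: "d \<in> {1..int (k\<^sup>2)}"
      then obtain x y where "x \<in> X" "y \<in> Y" "y - x = d" using diffs by blast
      then show "d \<in> (\<lambda>(x, y). x \<otimes>\<^bsub>G\<^esub> inv\<^bsub>G\<^esub> y) ` (Y \<times> X)"
        using d diff[OF inX] by (intro image_eqI[of _ _ "(y, x)"]) (auto simp: n_def)
    qed
  qed (simp add: kX kY power2_eq_square flip: of_nat_mult)
  have XY: "count (diff_mset G X Y) g = 1" if "g \<in> {1..int (k\<^sup>2)}" for g
  proof (rule count_diff_mset_eq_1[OF finX finY _ _ that])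
    show "{1..int (k\<^sup>2)} \<subseteq> (\<lambda>(x, y). x \<otimes>\<^bsub>G\<^esub> inv\<^bsub>G\<^esub> y) ` (X \<times> Y)"
    proof
      fix d assume d: "d \<in> {1..int (k\<^sup>2)}"
      \<comment> \<open>The opposite differences come for free: if \<open>y - x\<close> is
        \<open>n - d\<close>, then \<open>x - y\<close> is congruent to \<open>d\<close>.\<close>
      then have "n - d \<in> {1..int (k\<^sup>2)}" by (auto simp: n_def)
      then obtain x y where xy: "x \<in> X" "y \<in> Y" "y - x = n - d" using diffs by blast
      then have "x - y = d - n" by linarith
      then have "(x - y) mod n = d" using d by (simp add: n_def)
      then show "d \<in> (\<lambda>(x, y). x \<otimes>\<^bsub>G\<^esub> inv\<^bsub>G\<^esub> y) ` (X \<times> Y)"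
        using xy diff[OF inY] by (intro image_eqI[of _ _ "(x, y)"]) auto
    qed
  qed (simp add: kX kY power2_eq_square flip: of_nat_mult)
  have "carrier G - {\<one>\<^bsub>G\<^esub>} = {1..int (k\<^sup>2)}" unfolding carr by (auto simp: G_def)
  moreover have "\<Union>({X, Y} - {X}) = Y" "\<Union>({X, Y} - {Y}) = X" using ne by auto
  moreover have "group G" by (simp add: G_def)
  moreover have "order G = k\<^sup>2 + 1" by (simp add: order_def carr nat_add_distrib nat_power_eq)
  ultimately have "is_SEDF G (k\<^sup>2 + 1) 2 k 1 {X, Y}"
    using X Y disj ne kX kY XY YX
    by (auto simp: is_SEDF_def carr disjoint_def)
  then show ?thesis by (simp add: G_def)
qed

text \<open>Division with rounding up: \<open>c\<close> is the ceiling of \<open>d / s\<close>,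
  computed as \<open>(d - 1) div s + 1\<close>, and \<open>r\<close> is the overshoot. Hence
  \<open>c\<close> starts at 1, like the multiples that make up the second set of each
  family.\<close>

lemma mult_minus_remainder_ex:
  fixes d m s :: int
  assumes "d \<in> {1..m * s}" "s > 0"
  shows "\<exists>c\<in>{1..m}. \<exists>r\<in>{0..s - 1}. d = c * s - r"
proof (intro bexI)
  let ?q = "(d - 1) div s" and ?r = "(d - 1) mod s"
  show "d = (?q + 1) * s - (s - 1 - ?r)"
    using div_mult_mod_eq[of "d - 1" s] by (simp add: algebra_simps)
  have "0 \<le> ?r" "?r < s" using assms by simp_all
  then show "s - 1 - ?r \<in> {0..s - 1}" by auto
  have "0 \<le> ?q" using assms by (auto intro!: pos_imp_zdiv_nonneg_iff[THEN iffD2])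
  moreover have "?q * s < m * s"
    using div_mult_mod_eq[of "d - 1" s] \<open>0 \<le> ?r\<close> assms(1) unfolding atLeastAtMost_iff by linarith
  then have "?q < m" using assms(2) by simp
  ultimately show "?q + 1 \<in> {1..m}" by simp
qed

text \<open>The invariant that separates the two families. A progression has it, with
  \<open>t\<close> the common difference and \<open>e\<close> the last term. Since \<open>e\<close>
  need not lie in \<open>S\<close>, a set with no exceptional point qualifies too; \<open>t\<close>
  is non-trivial because the identity translation fixes every set.\<close>

definition translates_except_one :: "('a, 'b) monoid_scheme \<Rightarrow> 'a set \<Rightarrow> bool" where
  "translates_except_one G S \<longleftrightarrow>
     (\<exists>t\<in>carrier G - {\<one>\<^bsub>G\<^esub>}. \<exists>e. \<forall>x\<in>S - {e}. x \<otimes>\<^bsub>G\<^esub> t \<in> S)"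

text \<open>The affine map turns translation by \<open>t\<close> into translation by
  \<open>\<alpha> t\<close>, where commutativity moves \<open>\<alpha> t\<close> past
  \<open>g\<close>; injectivity of \<open>\<alpha>\<close> keeps \<open>\<alpha> t\<close>
  non-trivial.\<close>

lemma translates_except_one_image:
  fixes G (structure)
  assumes "comm_group G" "\<alpha> \<in> iso G G" "g \<in> carrier G" "h \<in> carrier G" "S \<subseteq> carrier G"
    and "translates_except_one G S"
  shows "translates_except_one G ((\<lambda>x. h \<otimes> \<alpha> x \<otimes> g) ` S)"
proof -
  interpret comm_group G by fact
  obtain t e where t: "t \<in> carrier G" "t \<noteq> \<one>" and e: "\<And>x. x \<in> S - {e} \<Longrightarrow> x \<otimes> t \<in> S"
    using assms(6) by (auto simp: translates_except_one_def)
  have hom: "\<alpha> \<in> hom G G" and inj: "inj_on \<alpha> (carrier G)"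
    using assms(2) by (auto simp: iso_def bij_betw_def)
  have closed: "\<alpha> x \<in> carrier G" if "x \<in> carrier G" for x using hom that by (rule hom_in_carrier)
  have "\<alpha> \<one> = \<one>" using hom is_group by (simp add: hom_one)
  then have "\<alpha> t \<noteq> \<one>" using inj t by (metis inj_onD one_closed)
  moreover have "h \<otimes> \<alpha> x \<otimes> g \<otimes> \<alpha> t \<in> (\<lambda>x. h \<otimes> \<alpha> x \<otimes> g) ` S" if "x \<in> S - {e}" for x
  proof (rule image_eqI[OF _ e[OF that]])
    have "x \<in> carrier G" using that assms(5) by auto
    then show "h \<otimes> \<alpha> x \<otimes> g \<otimes> \<alpha> t = h \<otimes> \<alpha> (x \<otimes> t) \<otimes> g"
      using t assms(3,4) closed by (simp add: hom_mult[OF hom] m_ac)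
  qed
  ultimately show ?thesis
    unfolding translates_except_one_def
    using t closed
    by (intro bexI[of _ "\<alpha> t"] exI[of _ "h \<otimes> \<alpha> e \<otimes> g"]) auto
qed

text \<open>The unordered form of equivalence does not tell which member is mapped onto
  \<open>B\<close>, so the property is asked of all of them.\<close>

lemma SEDF_equivalent_translates_except_one:
  fixes G (structure)
  assumes "comm_group G" "SEDF_equivalent G \<A> \<A>'" "B \<in> \<A>'"
    and "\<And>A. A \<in> \<A> \<Longrightarrow> A \<subseteq> carrier G \<and> translates_except_one G A"
  shows "translates_except_one G B"
  using assms translates_except_one_image[OF assms(1)] unfolding SEDF_equivalent_def
  by (smt (verit) image_iff)

text \<open>Each non-zero \<open>t\<close> pushes two chosen points out of the set. With
  \<open>a \<ge> 2\<close> each block has two points; for \<open>a = 1\<close> the set is the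
  progression 0, 2.\<close>

lemma not_translates_except_one_two_intervals:
  fixes a :: int
  assumes "a \<ge> 2"
  shows "\<not> translates_except_one (integer_mod_group (nat (4 * a\<^sup>2 + 1)))
           ({0..a - 1} \<union> {2 * a..3 * a - 1})" (is "\<not> translates_except_one ?G ?B")
proof
  define n where "n = 4 * a\<^sup>2 + 1"
  have n: "int (nat (4 * a\<^sup>2 + 1)) = n" and npos: "n > 0"
    by (simp_all add: n_def add_nonneg_pos)
  \<comment> \<open>Half of \<open>n - 1\<close> is at least \<open>3 * a - 1\<close>: shifts up to
    that half do not wrap around, and larger ones carry 0 beyond the upper block.\<close>
  have sq: "2 * a\<^sup>2 + 2 > 3 * a"
    using mult_right_mono[of 2 a a] assms unfolding power2_eq_square by linarith
  assume "translates_except_one ?G ?B"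
  then obtain t e where "t \<in> carrier ?G" "t \<noteq> 0"
    and e: "\<forall>x\<in>?B - {e}. (x + t) mod n \<in> ?B"
    unfolding translates_except_one_def one_integer_mod_group mult_integer_mod_group n by blast
  then have t: "1 \<le> t" "t < n"
    using n npos by (auto simp: carrier_integer_mod_group simp del: int_nat_eq split: if_splits)
  from e have stay: "x = y \<or> (x + t) mod n \<in> ?B \<or> (y + t) mod n \<in> ?B"
    if "x \<in> ?B" "y \<in> ?B" for x y
    using that by blast
  show False
  proof (cases "t \<le> 2 * a\<^sup>2")
    case True
    have m: "(x + t) mod n = x + t" if "0 \<le> x" "x \<le> 3 * a - 1" for x
      using that True t sq by (simp add: n_def)
    show False
    \<comment> \<open>For \<open>t = 1\<close> the last points of both blocks leave; for larger
      \<open>t\<close> the two topmost points both land above the upper block.\<close>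
    proof (cases "t = 1")
      case True
      then show False using stay[of "a - 1" "3 * a - 1"] m[of "a - 1"] m[of "3 * a - 1"] assms
        by auto
    next
      case False
      then show False using stay[of "3 * a - 2" "3 * a - 1"] m[of "3 * a - 2"] m[of "3 * a - 1"] t assms
        by auto
    qed
  next
    case False
    have m: "(x + t) mod n = x + t" if "x + t < n" "0 \<le> x" for x
      using that t by simp
    show False
    \<comment> \<open>The mirror image: for translation by -1 the first points of both blocks leave;
      otherwise 0 and 1 land above the upper block without wrapping.\<close>
    proof (cases "t = n - 1")
      case True
      have "(2 * a + t) mod n = 2 * a - 1"
        using True sq assms mod_add_self2[of "2 * a - 1" n] by (simp add: n_def algebra_simps)
      then show False using stay[of 0 "2 * a"] m[of 0] True sq False assms
        by (auto simp: n_def)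
    next
      case False
      then show False
        using stay[of 0 1] m[of 0] m[of 1] t sq \<open>\<not> t \<le> 2 * a\<^sup>2\<close> assms by (auto simp: n_def)
    qed
  qed
qed

theorem theorem5p1:
  fixes a k :: nat and G :: "int monoid" and A1 A2 B1 B2 :: "int set"
  assumes "a \<ge> 1" and "k = 2 * a"
    and "G = integer_mod_group (k\<^sup>2 + 1)"
    and "B1 = {0..int a - 1} \<union> {2 * int a..3 * int a - 1}"
    and "B2 = (\<Union>i\<in>{1..int a}. {(4 * i - 1) * int a, 4 * i * int a})"
    and "A1 = {0..int k - 1}"
    and "A2 = {j * int k |j. j \<in> {1..int k}}"
  shows "is_SEDF G (k\<^sup>2 + 1) 2 k 1 {B1, B2} \<and>
    (k > 2 \<longrightarrow>
       is_SEDF G (k\<^sup>2 + 1) 2 k 1 {A1, A2} \<and>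
       \<not> SEDF_equivalent G {A1, A2} {B1, B2})"
proof (intro conjI impI)
  have k1: "k \<ge> 1" using assms by simp
  have k2: "int (k\<^sup>2) = 4 * int a * int a" "int (k\<^sup>2) = int k * int k"
    using assms(2) by (simp_all add: power2_eq_square)
  have a1: "int a \<ge> 1" using assms by simp
  have aa: "int a \<le> int a * int a" using mult_mono[of 1 "int a" "int a" "int a"] a1 by simp
  have kk: "int k \<le> int k * int k" using mult_mono[of 1 "int k" "int k" "int k"] k1 by simp
  have B1: "B1 \<subseteq> {0..int (k\<^sup>2)}"
    unfolding assms(4) k2(1) mult.assoc
    by (intro Un_least; subst atLeastatMost_subset_iff) (use aa a1 in linarith)+
  have A1: "A1 \<subseteq> {0..int (k\<^sup>2)}" unfolding assms(6) k2(2) using kk by auto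
  have A2_image: "A2 = (\<lambda>j. j * int k) ` {1..int k}" using assms(7) by auto
  have A2: "A2 \<subseteq> {0..int (k\<^sup>2)}" unfolding A2_image k2(2)
    by (auto intro: mult_right_mono)

  show "is_SEDF G (k\<^sup>2 + 1) 2 k 1 {B1, B2}" unfolding assms(3)
  proof (rule is_SEDF_integer_mod_group[OF k1 B1])
    show "B2 \<subseteq> {0..int (k\<^sup>2)}"
    proof -
      have "c * int a \<in> {0..int (k\<^sup>2)}" if "0 \<le> c" "c \<le> 4 * int a" for c
        using that mult_right_mono[of c "4 * int a" "int a"] unfolding k2(1) by simp
      then show ?thesis unfolding assms(5) by force
    qed
    show "card B1 \<le> k"
      using card_Un_le[of "{0..int a - 1}" "{2 * int a..3 * int a - 1}"] assms(2,4) by simp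
    have "card B2 \<le> (\<Sum>i\<in>{1..int a}. card {(4 * i - 1) * int a, 4 * i * int a})"
      unfolding assms(5) by (rule card_UN_le) simp
    also have "\<dots> \<le> (\<Sum>i\<in>{1..int a}. 2)"
      by (intro sum_mono) (simp add: card_insert_if)
    finally show "card B2 \<le> k" using assms(2) by simp
  next
    fix d assume "d \<in> {1..int (k\<^sup>2)}"
    then obtain c r where c: "c \<in> {1..4 * int a}" and r: "r \<in> {0..int a - 1}"
      and d: "d = c * int a - r"
      using mult_minus_remainder_ex[of d "4 * int a" "int a"] a1 unfolding k2(1) by auto
    \<comment> \<open>\<open>i\<close> is the ceiling of \<open>c / 4\<close>. \<open>B2\<close>
      holds the multiples of \<open>a\<close> whose coefficient is 0 or 3 modulo 4; subtracting the
      offset \<open>2 * a\<close> of the upper block of \<open>B1\<close> supplies the classes 2 and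
      1.\<close>
    define i where "i = (c + 3) div 4"
    have i: "i \<in> {1..int a}" using c by (auto simp: i_def)
    then have B2: "(4 * i - 1) * int a \<in> B2" "4 * i * int a \<in> B2" unfolding assms(5) by blast+
    have B1: "r \<in> B1" "2 * int a + r \<in> B1" using r unfolding assms(4) by auto
    have "c = 4 * i \<or> c = 4 * i - 1 \<or> c = 4 * i - 2 \<or> c = 4 * i - 3"
      unfolding i_def by presburger
    then consider "c = 4 * i" | "c = 4 * i - 1" | "c = 4 * i - 2" | "c = 4 * i - 3" by blast
    then show "\<exists>x\<in>B1. \<exists>y\<in>B2. y - x = d"
    proof cases
      case 1
      then show ?thesis using B1 B2 d by blast
    next
      case 2
      then show ?thesis using B1 B2 d by blast
    next
      case 3
      have "4 * i * int a - (2 * int a + r) = d" unfolding d 3 by (simp add: algebra_simps)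
      then show ?thesis using B1 B2 by blast
    next
      case 4
      have "(4 * i - 1) * int a - (2 * int a + r) = d" unfolding d 4 by (simp add: algebra_simps)
      then show ?thesis using B1 B2 by blast
    qed
  qed

  assume "k > 2"
  then have a2: "int a \<ge> 2" using assms(2) by simp
  show "is_SEDF G (k\<^sup>2 + 1) 2 k 1 {A1, A2}" unfolding assms(3)
  proof (rule is_SEDF_integer_mod_group[OF k1 A1 A2])
    show "card A1 \<le> k" using assms(6) by simp
    show "card A2 \<le> k" unfolding A2_image using card_image_le[of "{1..int k}"] by force
  next
    fix d assume "d \<in> {1..int (k\<^sup>2)}"
    then obtain c r where "c \<in> {1..int k}" "r \<in> {0..int k - 1}" "d = c * int k - r"
      using mult_minus_remainder_ex[of d "int k" "int k"] k1 unfolding k2(2) by auto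
    then show "\<exists>x\<in>A1. \<exists>y\<in>A2. y - x = d" unfolding assms(6) A2_image by blast
  qed

  have comm: "comm_group G" by (simp add: assms(3))
  have carr: "carrier G = {0..int (k\<^sup>2)}"
    by (auto simp: assms(3) carrier_integer_mod_group)
  \<comment> \<open>The sums used below stay inside \<open>A1\<close> or \<open>A2\<close>, so no
    reduction occurs.\<close>
  have add: "x \<otimes>\<^bsub>G\<^esub> y = x + y" if "x + y \<in> {0..int (k\<^sup>2)}" for x y
    using that by (simp add: assms(3))
  have one: "\<one>\<^bsub>G\<^esub> = 0" by (simp add: assms(3))
  have "x \<otimes>\<^bsub>G\<^esub> 1 \<in> A1" if "x \<in> A1 - {int k - 1}" for x
  proof -
    have "x + 1 \<in> A1" using that unfolding assms(6) by auto
    then show ?thesis using add A1 by auto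
  qed
  moreover have "1 \<in> carrier G - {\<one>\<^bsub>G\<^esub>}"
    unfolding carr one k2(2) Diff_iff atLeastAtMost_iff using kk k1 by (simp del: of_nat_mult; linarith)
  ultimately have tA1: "translates_except_one G A1"
    unfolding translates_except_one_def by blast
  \<comment> \<open>\<open>A2\<close> is a progression with difference \<open>k\<close>; the
    excluded point is its last term.\<close>
  have "x \<otimes>\<^bsub>G\<^esub> int k \<in> A2" if x: "x \<in> A2 - {int k * int k}" for x
  proof -
    obtain j where j: "x = j * int k" "j \<in> {1..int k}" using x unfolding A2_image by auto
    then have "j + 1 \<in> {1..int k}" using x by (cases "j = int k") auto
    moreover have "x + int k = (j + 1) * int k" using j by (simp add: algebra_simps)
    ultimately have "x + int k \<in> A2" unfolding A2_image by blast
    then show ?thesis using add A2 by auto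
  qed
  moreover have "int k \<in> carrier G - {\<one>\<^bsub>G\<^esub>}" unfolding carr one k2(2) using kk k1 by auto
  ultimately have tA2: "translates_except_one G A2"
    unfolding translates_except_one_def by blast
  have "nat (4 * (int a)\<^sup>2 + 1) = k\<^sup>2 + 1"
    using k2(1) by (simp add: power2_eq_square nat_eq_iff)
  then have "\<not> translates_except_one G B1"
    using not_translates_except_one_two_intervals[OF a2] assms(3,4) by simp
  then show "\<not> SEDF_equivalent G {A1, A2} {B1, B2}"
    using SEDF_equivalent_translates_except_one[OF comm, of "{A1, A2}" "{B1, B2}" B1]
      tA1 tA2 A1 A2 carr by blast
qed

end
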